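(* Suppose $M$ and $N$ are models of set theory and $j:M\to N$ is an elementary embedding. Then the following are equivalent: (1) $j$ is close to $M$; (2) for every $A\in N$, $j^{-1}[A]=\{x\in M : N\models j(x)\in A\}$ belongs to $M$.
   Context: Models of set theory are models of ZFC, possibly ill-founded; a subset of $M$ "belongs to $M$" if it is the extension $\{y: M\models y\in x\}$ of some $x\in M$. $j:M\to N$ is cofinal if for every $a\in N$ there is $X\in M$ with $N\models a\in j(X)$. For $X\in M$ and $a\in N$ with $N\models a\in j(X)$, the $M$-ultrafilter over $X$ derived from $j$ using $a$ is $\{A\in P^M(X): N\models a\in j(A)\}$. $j$ is close to $M$ if $j$ is cofinal and every $M$-ultrafilter derived from $j$ belongs to $M$. *)

theory Defs
  imports Main
begin

record 'a eps_struct =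
  univ :: "'a set"
  eps :: "'a \<Rightarrow> 'a \<Rightarrow> bool"  (infix "\<epsilon>\<index>" 50)

text \<open>First-order formulas of the language of set theory. Variables are named by natural
  numbers and assignments are total; only finitely many values matter for any given formula,
  so the remaining values of an assignment serve as parameters.\<close>

datatype fm =
    FMem nat nat
  | FEq nat nat
  | FNeg fm
  | FConj fm fm
  | FForall nat fm

primrec sat :: "'a eps_struct \<Rightarrow> (nat \<Rightarrow> 'a) \<Rightarrow> fm \<Rightarrow> bool" where
  "sat M e (FMem m n) \<longleftrightarrow> e m \<epsilon>\<^bsub>M\<^esub> e n"
| "sat M e (FEq m n) \<longleftrightarrow> e m = e n"
| "sat M e (FNeg p) \<longleftrightarrow> \<not> sat M e p"
| "sat M e (FConj p q) \<longleftrightarrow> sat M e p \<and> sat M e q"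
| "sat M e (FForall n p) \<longleftrightarrow> (\<forall>x\<in>univ M. sat M (e(n := x)) p)"

definition assignment :: "'a eps_struct \<Rightarrow> (nat \<Rightarrow> 'a) \<Rightarrow> bool" where
  "assignment M e \<longleftrightarrow> (\<forall>n. e n \<in> univ M)"

definition sub_in :: "'a eps_struct \<Rightarrow> 'a \<Rightarrow> 'a \<Rightarrow> bool" where
  "sub_in M x y \<longleftrightarrow> (\<forall>z\<in>univ M. z \<epsilon>\<^bsub>M\<^esub> x \<longrightarrow> z \<epsilon>\<^bsub>M\<^esub> y)"

text \<open>The axioms of ZFC, each given as its satisfaction in \<open>M\<close> (all quantifiers bounded by
  the universe of \<open>M\<close>). The two schemata range over all formulas and all parameters from \<open>M\<close>.\<close>

definition ax_extensionality :: "'a eps_struct \<Rightarrow> bool" where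
  "ax_extensionality M \<longleftrightarrow>
     (\<forall>x\<in>univ M. \<forall>y\<in>univ M.
        (\<forall>z\<in>univ M. z \<epsilon>\<^bsub>M\<^esub> x \<longleftrightarrow> z \<epsilon>\<^bsub>M\<^esub> y) \<longrightarrow> x = y)"

definition ax_foundation :: "'a eps_struct \<Rightarrow> bool" where
  "ax_foundation M \<longleftrightarrow>
     (\<forall>x\<in>univ M. (\<exists>y\<in>univ M. y \<epsilon>\<^bsub>M\<^esub> x) \<longrightarrow>
        (\<exists>y\<in>univ M. y \<epsilon>\<^bsub>M\<^esub> x \<and> \<not> (\<exists>z\<in>univ M. z \<epsilon>\<^bsub>M\<^esub> x \<and> z \<epsilon>\<^bsub>M\<^esub> y)))"

definition ax_pairing :: "'a eps_struct \<Rightarrow> bool" where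
  "ax_pairing M \<longleftrightarrow>
     (\<forall>x\<in>univ M. \<forall>y\<in>univ M. \<exists>p\<in>univ M. \<forall>z\<in>univ M.
        z \<epsilon>\<^bsub>M\<^esub> p \<longleftrightarrow> z = x \<or> z = y)"

definition ax_union :: "'a eps_struct \<Rightarrow> bool" where
  "ax_union M \<longleftrightarrow>
     (\<forall>F\<in>univ M. \<exists>U\<in>univ M. \<forall>x\<in>univ M.
        x \<epsilon>\<^bsub>M\<^esub> U \<longleftrightarrow> (\<exists>y\<in>univ M. y \<epsilon>\<^bsub>M\<^esub> F \<and> x \<epsilon>\<^bsub>M\<^esub> y))"

definition ax_power_set :: "'a eps_struct \<Rightarrow> bool" where
  "ax_power_set M \<longleftrightarrow>
     (\<forall>x\<in>univ M. \<exists>P\<in>univ M. \<forall>y\<in>univ M. y \<epsilon>\<^bsub>M\<^esub> P \<longleftrightarrow> sub_in M y x)"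

definition ax_infinity :: "'a eps_struct \<Rightarrow> bool" where
  "ax_infinity M \<longleftrightarrow>
     (\<exists>I\<in>univ M.
        (\<exists>u\<in>univ M. u \<epsilon>\<^bsub>M\<^esub> I \<and> (\<forall>z\<in>univ M. \<not> z \<epsilon>\<^bsub>M\<^esub> u)) \<and>
        (\<forall>x\<in>univ M. x \<epsilon>\<^bsub>M\<^esub> I \<longrightarrow>
           (\<exists>s\<in>univ M. s \<epsilon>\<^bsub>M\<^esub> I \<and>
              (\<forall>z\<in>univ M. z \<epsilon>\<^bsub>M\<^esub> s \<longleftrightarrow> z \<epsilon>\<^bsub>M\<^esub> x \<or> z = x))))"

definition ax_separation :: "'a eps_struct \<Rightarrow> bool" where
  "ax_separation M \<longleftrightarrow>
     (\<forall>p e. assignment M e \<longrightarrow>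
        (\<forall>A\<in>univ M. \<exists>B\<in>univ M. \<forall>x\<in>univ M.
           x \<epsilon>\<^bsub>M\<^esub> B \<longleftrightarrow> x \<epsilon>\<^bsub>M\<^esub> A \<and> sat M (e(0 := x)) p))"

definition ax_replacement :: "'a eps_struct \<Rightarrow> bool" where
  "ax_replacement M \<longleftrightarrow>
     (\<forall>p e. assignment M e \<longrightarrow>
        (\<forall>A\<in>univ M.
           (\<forall>x\<in>univ M. x \<epsilon>\<^bsub>M\<^esub> A \<longrightarrow>
              (\<forall>y\<in>univ M. \<forall>z\<in>univ M.
                 sat M (e(0 := x, 1 := y)) p \<and> sat M (e(0 := x, 1 := z)) p \<longrightarrow> y = z)) \<longrightarrow>
           (\<exists>B\<in>univ M. \<forall>y\<in>univ M.
              y \<epsilon>\<^bsub>M\<^esub> B \<longleftrightarrow>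
                (\<exists>x\<in>univ M. x \<epsilon>\<^bsub>M\<^esub> A \<and> sat M (e(0 := x, 1 := y)) p))))"

text \<open>Choice: every family of nonempty, pairwise disjoint sets has a transversal.\<close>

definition ax_choice :: "'a eps_struct \<Rightarrow> bool" where
  "ax_choice M \<longleftrightarrow>
     (\<forall>F\<in>univ M.
        (\<forall>x\<in>univ M. x \<epsilon>\<^bsub>M\<^esub> F \<longrightarrow> (\<exists>y\<in>univ M. y \<epsilon>\<^bsub>M\<^esub> x)) \<and>
        (\<forall>x\<in>univ M. \<forall>y\<in>univ M. x \<epsilon>\<^bsub>M\<^esub> F \<and> y \<epsilon>\<^bsub>M\<^esub> F \<and> x \<noteq> y \<longrightarrow>
           \<not> (\<exists>z\<in>univ M. z \<epsilon>\<^bsub>M\<^esub> x \<and> z \<epsilon>\<^bsub>M\<^esub> y)) \<longrightarrow>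
        (\<exists>C\<in>univ M. \<forall>x\<in>univ M. x \<epsilon>\<^bsub>M\<^esub> F \<longrightarrow>
           (\<exists>!y. y \<in> univ M \<and> y \<epsilon>\<^bsub>M\<^esub> x \<and> y \<epsilon>\<^bsub>M\<^esub> C)))"

definition ZFC_model :: "'a eps_struct \<Rightarrow> bool" where
  "ZFC_model M \<longleftrightarrow>
     ax_extensionality M \<and> ax_foundation M \<and> ax_pairing M \<and> ax_union M \<and> ax_power_set M \<and>
     ax_infinity M \<and> ax_separation M \<and> ax_replacement M \<and> ax_choice M"

definition elementary_embedding ::
    "'a eps_struct \<Rightarrow> 'b eps_struct \<Rightarrow> ('a \<Rightarrow> 'b) \<Rightarrow> bool" where
  "elementary_embedding M N j \<longleftrightarrow>
     (\<forall>x\<in>univ M. j x \<in> univ N) \<and>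
     (\<forall>p e. assignment M e \<longrightarrow> (sat M e p \<longleftrightarrow> sat N (j \<circ> e) p))"

definition belongs_to :: "'a set \<Rightarrow> 'a eps_struct \<Rightarrow> bool" where
  "belongs_to S M \<longleftrightarrow> (\<exists>x\<in>univ M. S = {y \<in> univ M. y \<epsilon>\<^bsub>M\<^esub> x})"

definition cofinal_emb :: "'a eps_struct \<Rightarrow> 'b eps_struct \<Rightarrow> ('a \<Rightarrow> 'b) \<Rightarrow> bool" where
  "cofinal_emb M N j \<longleftrightarrow> (\<forall>a\<in>univ N. \<exists>X\<in>univ M. a \<epsilon>\<^bsub>N\<^esub> j X)"

text \<open>The extension of the power set of \<open>X\<close> as computed in \<open>M\<close>.\<close>

definition Pow_in :: "'a eps_struct \<Rightarrow> 'a \<Rightarrow> 'a set" where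
  "Pow_in M X = {A \<in> univ M. sub_in M A X}"

definition derived_ultrafilter ::
    "'a eps_struct \<Rightarrow> 'b eps_struct \<Rightarrow> ('a \<Rightarrow> 'b) \<Rightarrow> 'a \<Rightarrow> 'b \<Rightarrow> 'a set" where
  "derived_ultrafilter M N j X a = {A \<in> Pow_in M X. a \<epsilon>\<^bsub>N\<^esub> j A}"

definition close_to :: "'a eps_struct \<Rightarrow> 'b eps_struct \<Rightarrow> ('a \<Rightarrow> 'b) \<Rightarrow> bool" where
  "close_to M N j \<longleftrightarrow>
     cofinal_emb M N j \<and>
     (\<forall>X\<in>univ M. \<forall>a\<in>univ N. a \<epsilon>\<^bsub>N\<^esub> j X \<longrightarrow>
        belongs_to (derived_ultrafilter M N j X a) M)"

end

theory Submission
  imports Defs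
begin

text \<open>If \<open>j\<close> is close and \<open>A \<in> j(Y)\<close>, let \<open>D\<close> be the ultrafilter over \<open>Y\<close> derived using \<open>A\<close>. Then
  \<open>j(x) \<in> A\<close> iff \<open>x \<in> \<Union>Y\<close> and \<open>{B \<in> Y. x \<in> B} \<in> D\<close>, so \<open>D\<close> computes the preimage of \<open>A\<close> inside
  \<open>M\<close>. Conversely, the ultrafilter over \<open>X\<close> derived using \<open>a\<close> is the preimage of
  \<open>{B \<in> j(P(X)). a \<in> B}\<close>. For cofinality, choose a level \<open>A = V\<^sub>\<alpha>\<close> of \<open>N\<close> containing \<open>a\<close>. Its
  preimage is a set of \<open>M\<close>, so some \<open>x\<close> lies outside it; if \<open>x\<close> belongs to the level \<open>X\<close> of \<open>M\<close>, then
  \<open>j(X)\<close> is a level of \<open>N\<close> not contained in \<open>A\<close>, and since levels form a chain, \<open>a \<in> A \<subseteq> j(X)\<close>.\<close>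

section \<open>Definability\<close>

primrec max_var :: "fm \<Rightarrow> nat" where
  "max_var (FMem m n) = max m n"
| "max_var (FEq m n) = max m n"
| "max_var (FNeg p) = max_var p"
| "max_var (FConj p q) = max (max_var p) (max_var q)"
| "max_var (FForall n p) = max n (max_var p)"

text \<open>Lets values above \<open>max_var p\<close> be ignored: the renaming used below for de
  Bruijn quantifiers shifts only finitely many variables.\<close>

lemma sat_cong:
  "(\<And>i. i \<le> max_var p \<Longrightarrow> e i = e' i) \<Longrightarrow> sat M e p \<longleftrightarrow> sat M e' p"
proof (induction p arbitrary: e e')
  case (FMem m n)
  then have "e m = e' m" "e n = e' n" by simp_all
  then show ?case by simp
next
  case (FEq m n)
  then have "e m = e' m" "e n = e' n" by simp_all
  then show ?case by simp
next
  case (FNeg p)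
  have "sat M e p \<longleftrightarrow> sat M e' p" by (rule FNeg.IH) (use FNeg.prems in simp)
  then show ?case by simp
next
  case (FConj p q)
  have "sat M e p \<longleftrightarrow> sat M e' p" by (rule FConj.IH) (use FConj.prems in simp)
  moreover have "sat M e q \<longleftrightarrow> sat M e' q" by (rule FConj.IH) (use FConj.prems in simp)
  ultimately show ?case by simp
next
  case (FForall n p)
  have "sat M (e(n := x)) p \<longleftrightarrow> sat M (e'(n := x)) p" for x
    by (rule FForall.IH) (use FForall.prems in simp)
  then show ?case by simp
qed

text \<open>Bound variables are renamed together with the free ones. For injective \<open>r\<close>
  this is sound, and no capture can occur.\<close>

primrec rename :: "(nat \<Rightarrow> nat) \<Rightarrow> fm \<Rightarrow> fm" where
  "rename r (FMem m n) = FMem (r m) (r n)"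
| "rename r (FEq m n) = FEq (r m) (r n)"
| "rename r (FNeg p) = FNeg (rename r p)"
| "rename r (FConj p q) = FConj (rename r p) (rename r q)"
| "rename r (FForall n p) = FForall (r n) (rename r p)"

lemma sat_rename:
  assumes "inj r"
  shows "sat M e (rename r p) \<longleftrightarrow> sat M (e \<circ> r) p"
proof (induction p arbitrary: e)
  case (FForall n p)
  have "(e(r n := x)) \<circ> r = (e \<circ> r)(n := x)" for x
    using assms by (auto simp: fun_eq_iff inj_eq)
  then show ?case by (simp only: rename.simps sat.simps FForall.IH)
qed auto

text \<open>Turns quantification over a named variable into quantification over slot 0 with all
  other slots shifted by one. A single \<open>q\<close> must serve both structures, because
  elementarity compares the same formula on both sides.\<close>

lemma sat_forall_case_nat:
  fixes M :: "'a eps_struct" and N :: "'b eps_struct"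
  obtains q where "\<And>e. sat M e q \<longleftrightarrow> (\<forall>x\<in>univ M. sat M (case_nat x e) p)"
    and "\<And>e. sat N e q \<longleftrightarrow> (\<forall>x\<in>univ N. sat N (case_nat x e) p)"
proof -
  define k where "k = max_var p"
  \<comment> \<open>A cyclic permutation of 0, ..., \<open>k\<close>, hence injective. Composed with
    it, \<open>e(k := x)\<close> agrees with \<open>case_nat x e\<close> up to \<open>k\<close>,
    that is, on every variable of \<open>p\<close>.\<close>
  define r where "r i = (if i = 0 then k else if i \<le> k then i - 1 else i)" for i
  have "inj r" by (auto simp: inj_def r_def split: if_splits)
  have *: "sat M (e(k := x)) (rename r p) \<longleftrightarrow> sat M (case_nat x e) p"
    for M :: "'c eps_struct" and e x
    unfolding sat_rename[OF \<open>inj r\<close>]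
    by (rule sat_cong) (auto simp: r_def k_def split: nat.split)
  show ?thesis by (rule that[of "FForall k (rename r p)"]) (simp_all add: *)
qed

text \<open>One formula defines \<open>P\<close> over \<open>M\<close> and \<open>Q\<close> over
  \<open>N\<close>. Predicates can then be written in the logic itself, and syntax is confined to
  the closure rules: with two structures this feeds elementarity, with one it feeds separation and
  replacement.\<close>

definition codefinable ::
    "'a eps_struct \<Rightarrow> 'b eps_struct \<Rightarrow> ((nat \<Rightarrow> 'a) \<Rightarrow> bool) \<Rightarrow> ((nat \<Rightarrow> 'b) \<Rightarrow> bool) \<Rightarrow> bool" where
  "codefinable M N P Q \<longleftrightarrow>
     (\<exists>p. (\<forall>e. assignment M e \<longrightarrow> (sat M e p \<longleftrightarrow> P e)) \<and>
          (\<forall>e. assignment N e \<longrightarrow> (sat N e p \<longleftrightarrow> Q e)))"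

abbreviation definable :: "'a eps_struct \<Rightarrow> ((nat \<Rightarrow> 'a) \<Rightarrow> bool) \<Rightarrow> bool" where
  "definable M P \<equiv> codefinable M M P P"

text \<open>Nothing is assumed about \<open>\<epsilon>\<close> outside the universe; building the universe into the relation
  lets bounded quantifiers be written without it.\<close>

definition mem :: "'a eps_struct \<Rightarrow> 'a \<Rightarrow> 'a \<Rightarrow> bool" where
  "mem M x y \<longleftrightarrow> x \<in> univ M \<and> y \<in> univ M \<and> x \<epsilon>\<^bsub>M\<^esub> y"

lemma codefinable_mem:
  "codefinable M N (\<lambda>e. mem M (e m) (e n)) (\<lambda>e. mem N (e m) (e n))"
  unfolding codefinable_def by (rule exI[of _ "FMem m n"]) (auto simp: mem_def assignment_def)

lemma codefinable_eq: "codefinable M N (\<lambda>e. e m = e n) (\<lambda>e. e m = e n)"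
  unfolding codefinable_def by (rule exI[of _ "FEq m n"]) auto

lemma codefinable_neg:
  assumes "codefinable M N P Q"
  shows "codefinable M N (\<lambda>e. \<not> P e) (\<lambda>e. \<not> Q e)"
proof -
  obtain p where "\<forall>e. assignment M e \<longrightarrow> (sat M e p \<longleftrightarrow> P e)"
    "\<forall>e. assignment N e \<longrightarrow> (sat N e p \<longleftrightarrow> Q e)"
    using assms unfolding codefinable_def by blast
  then show ?thesis unfolding codefinable_def by (intro exI[of _ "FNeg p"]) simp
qed

lemma codefinable_conj:
  assumes "codefinable M N P Q" "codefinable M N P' Q'"
  shows "codefinable M N (\<lambda>e. P e \<and> P' e) (\<lambda>e. Q e \<and> Q' e)"
proof -
  obtain p where "\<forall>e. assignment M e \<longrightarrow> (sat M e p \<longleftrightarrow> P e)"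
    "\<forall>e. assignment N e \<longrightarrow> (sat N e p \<longleftrightarrow> Q e)"
    using assms unfolding codefinable_def by blast
  moreover obtain p' where "\<forall>e. assignment M e \<longrightarrow> (sat M e p' \<longleftrightarrow> P' e)"
    "\<forall>e. assignment N e \<longrightarrow> (sat N e p' \<longleftrightarrow> Q' e)"
    using assms unfolding codefinable_def by blast
  ultimately show ?thesis unfolding codefinable_def by (intro exI[of _ "FConj p p'"]) simp
qed

lemma codefinable_disj:
  assumes "codefinable M N P Q" "codefinable M N P' Q'"
  shows "codefinable M N (\<lambda>e. P e \<or> P' e) (\<lambda>e. Q e \<or> Q' e)"
  using codefinable_neg[OF codefinable_conj[OF assms[THEN codefinable_neg]]] by simp

lemma codefinable_imp:
  assumes "codefinable M N P Q" "codefinable M N P' Q'"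
  shows "codefinable M N (\<lambda>e. P e \<longrightarrow> P' e) (\<lambda>e. Q e \<longrightarrow> Q' e)"
  unfolding imp_conv_disj by (intro codefinable_disj codefinable_neg assms)

lemma codefinable_iff:
  assumes "codefinable M N P Q" "codefinable M N P' Q'"
  shows "codefinable M N (\<lambda>e. P e \<longleftrightarrow> P' e) (\<lambda>e. Q e \<longleftrightarrow> Q' e)"
  unfolding iff_conv_conj_imp by (intro codefinable_conj codefinable_imp assms)

text \<open>Quantifiers are handled in de Bruijn style, so that the rules apply by plain resolution
  without freshness conditions.\<close>

lemma codefinable_ball:
  assumes "codefinable M N (\<lambda>e. P (e 0) (\<lambda>i. e (Suc i))) (\<lambda>e. Q (e 0) (\<lambda>i. e (Suc i)))"
  shows "codefinable M N (\<lambda>e. \<forall>x\<in>univ M. P x e) (\<lambda>e. \<forall>x\<in>univ N. Q x e)"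
proof -
  obtain p where p: "\<And>e. assignment M e \<Longrightarrow> sat M e p \<longleftrightarrow> P (e 0) (\<lambda>i. e (Suc i))"
    "\<And>e. assignment N e \<Longrightarrow> sat N e p \<longleftrightarrow> Q (e 0) (\<lambda>i. e (Suc i))"
    using assms unfolding codefinable_def by blast
  obtain q where q: "\<And>e. sat M e q \<longleftrightarrow> (\<forall>x\<in>univ M. sat M (case_nat x e) p)"
    "\<And>e. sat N e q \<longleftrightarrow> (\<forall>x\<in>univ N. sat N (case_nat x e) p)"
    by (rule sat_forall_case_nat) (rule that)
  have M: "sat M (case_nat x e) p \<longleftrightarrow> P x e" if "assignment M e" "x \<in> univ M" for x e
    using p(1)[of "case_nat x e"] that by (simp add: assignment_def split: nat.split)
  have N: "sat N (case_nat x e) p \<longleftrightarrow> Q x e" if "assignment N e" "x \<in> univ N" for x e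
    using p(2)[of "case_nat x e"] that by (simp add: assignment_def split: nat.split)
  show ?thesis unfolding codefinable_def
    by (rule exI[of _ q]) (simp add: q M N)
qed

lemma codefinable_bex:
  assumes "codefinable M N (\<lambda>e. P (e 0) (\<lambda>i. e (Suc i))) (\<lambda>e. Q (e 0) (\<lambda>i. e (Suc i)))"
  shows "codefinable M N (\<lambda>e. \<exists>x\<in>univ M. P x e) (\<lambda>e. \<exists>x\<in>univ N. Q x e)"
  using codefinable_neg[OF codefinable_ball[where P="\<lambda>x e. \<not> P x e" and Q="\<lambda>x e. \<not> Q x e",
    OF codefinable_neg[OF assms]]] by simp

text \<open>Since \<open>mem\<close> confines its arguments to the universe, a quantifier over the
  whole type guarded by \<open>mem\<close> is the same as one over the universe.\<close>

lemma codefinable_all_mem: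
  assumes "codefinable M N (\<lambda>e. P (e 0) (\<lambda>i. e (Suc i))) (\<lambda>e. Q (e 0) (\<lambda>i. e (Suc i)))"
  shows "codefinable M N (\<lambda>e. \<forall>x. mem M x (e n) \<longrightarrow> P x e) (\<lambda>e. \<forall>x. mem N x (e n) \<longrightarrow> Q x e)"
proof -
  have eq: "(\<forall>x. mem K x y \<longrightarrow> R x) \<longleftrightarrow> (\<forall>x\<in>univ K. mem K x y \<longrightarrow> R x)"
    for K :: "'c eps_struct" and y R
    by (auto simp: mem_def)
  show ?thesis
    unfolding eq by (intro codefinable_ball codefinable_imp codefinable_mem assms)
qed

lemma codefinable_ex_mem:
  assumes "codefinable M N (\<lambda>e. P (e 0) (\<lambda>i. e (Suc i))) (\<lambda>e. Q (e 0) (\<lambda>i. e (Suc i)))"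
  shows "codefinable M N (\<lambda>e. \<exists>x. mem M x (e n) \<and> P x e) (\<lambda>e. \<exists>x. mem N x (e n) \<and> Q x e)"
  using codefinable_neg[OF codefinable_all_mem[where P="\<lambda>x e. \<not> P x e" and Q="\<lambda>x e. \<not> Q x e",
    OF codefinable_neg[OF assms]]] by simp

lemmas codefinable_intros =
  codefinable_mem codefinable_eq codefinable_neg codefinable_conj codefinable_disj
  codefinable_imp codefinable_iff codefinable_ball codefinable_bex
  codefinable_all_mem codefinable_ex_mem

section \<open>Transfer along an elementary embedding\<close>

lemma elementary_embeddingD:
  assumes "elementary_embedding M N j" "codefinable M N P Q" "assignment M e"
  shows "P e \<longleftrightarrow> Q (j \<circ> e)"
proof -
  obtain p where p: "\<And>e. assignment M e \<Longrightarrow> sat M e p \<longleftrightarrow> P e"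
    "\<And>e. assignment N e \<Longrightarrow> sat N e p \<longleftrightarrow> Q e"
    using assms(2) unfolding codefinable_def by blast
  have "assignment N (j \<circ> e)"
    using assms(1,3) by (auto simp: elementary_embedding_def assignment_def)
  then show ?thesis
    using p assms(1,3) by (auto simp: elementary_embedding_def)
qed

lemma elementary_embedding_iff:
  assumes "elementary_embedding M N j"
    and "codefinable M N (\<lambda>e. P (e 0) (e 1) (e 2)) (\<lambda>e. Q (e 0) (e 1) (e 2))"
    and "x \<in> univ M" "y \<in> univ M" "z \<in> univ M"
  shows "P x y z \<longleftrightarrow> Q (j x) (j y) (j z)"
  \<comment> \<open>The third argument \<open>z\<close> doubles as the default value of all slots
    from 2 on.\<close>
  using elementary_embeddingD[OF assms(1,2), of "(\<lambda>_. z)(0 := x, 1 := y)"] assms(3-)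
  by (simp add: assignment_def)

lemma elementary_embedding_mem_iff:
  assumes "elementary_embedding M N j" "x \<in> univ M" "y \<in> univ M"
  shows "mem N (j x) (j y) \<longleftrightarrow> mem M x y"
  using elementary_embedding_iff[OF assms(1), where P="\<lambda>x y z. mem M x y" and
    Q="\<lambda>x y z. mem N x y", OF codefinable_mem assms(2,3,3)] by simp

section \<open>Formulas of set theory\<close>

definition sub :: "'a eps_struct \<Rightarrow> 'a \<Rightarrow> 'a \<Rightarrow> bool" where
  "sub M x y \<longleftrightarrow> (\<forall>z. mem M z x \<longrightarrow> mem M z y)"

lemma codefinable_sub:
  "codefinable M N (\<lambda>e. sub M (e m) (e n)) (\<lambda>e. sub N (e m) (e n))"
  unfolding sub_def by (intro codefinable_intros)

definition is_empty :: "'a eps_struct \<Rightarrow> 'a \<Rightarrow> bool" where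
  "is_empty M x \<longleftrightarrow> (\<forall>z\<in>univ M. \<not> mem M z x)"

lemma codefinable_is_empty:
  "codefinable M N (\<lambda>e. is_empty M (e m)) (\<lambda>e. is_empty N (e m))"
  unfolding is_empty_def by (intro codefinable_intros)

definition is_upair :: "'a eps_struct \<Rightarrow> 'a \<Rightarrow> 'a \<Rightarrow> 'a \<Rightarrow> bool" where
  "is_upair M p x y \<longleftrightarrow> (\<forall>z\<in>univ M. mem M z p \<longleftrightarrow> z = x \<or> z = y)"

lemma codefinable_is_upair:
  "codefinable M N (\<lambda>e. is_upair M (e k) (e m) (e n)) (\<lambda>e. is_upair N (e k) (e m) (e n))"
  unfolding is_upair_def by (intro codefinable_intros)

definition is_pair :: "'a eps_struct \<Rightarrow> 'a \<Rightarrow> 'a \<Rightarrow> 'a \<Rightarrow> bool" where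
  "is_pair M p x y \<longleftrightarrow>
     (\<exists>s\<in>univ M. \<exists>t\<in>univ M. is_upair M s x x \<and> is_upair M t x y \<and> is_upair M p s t)"

lemma codefinable_is_pair:
  "codefinable M N (\<lambda>e. is_pair M (e k) (e m) (e n)) (\<lambda>e. is_pair N (e k) (e m) (e n))"
  unfolding is_pair_def by (intro codefinable_intros codefinable_is_upair)

definition is_succ :: "'a eps_struct \<Rightarrow> 'a \<Rightarrow> 'a \<Rightarrow> bool" where
  "is_succ M s n \<longleftrightarrow> (\<forall>z\<in>univ M. mem M z s \<longleftrightarrow> mem M z n \<or> z = n)"

lemma codefinable_is_succ:
  "codefinable M N (\<lambda>e. is_succ M (e m) (e n)) (\<lambda>e. is_succ N (e m) (e n))"
  unfolding is_succ_def by (intro codefinable_intros)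

definition is_Union :: "'a eps_struct \<Rightarrow> 'a \<Rightarrow> 'a \<Rightarrow> bool" where
  "is_Union M u x \<longleftrightarrow> (\<forall>z\<in>univ M. mem M z u \<longleftrightarrow> (\<exists>y. mem M y x \<and> mem M z y))"

lemma codefinable_is_Union:
  "codefinable M N (\<lambda>e. is_Union M (e m) (e n)) (\<lambda>e. is_Union N (e m) (e n))"
  unfolding is_Union_def by (intro codefinable_intros)

definition is_inductive :: "'a eps_struct \<Rightarrow> 'a \<Rightarrow> bool" where
  "is_inductive M J \<longleftrightarrow>
     (\<forall>z\<in>univ M. is_empty M z \<longrightarrow> mem M z J) \<and>
     (\<forall>n. mem M n J \<longrightarrow> (\<forall>s\<in>univ M. is_succ M s n \<longrightarrow> mem M s J))"

lemma codefinable_is_inductive: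
  "codefinable M N (\<lambda>e. is_inductive M (e m)) (\<lambda>e. is_inductive N (e m))"
  unfolding is_inductive_def
  by (intro codefinable_intros codefinable_is_empty codefinable_is_succ)

text \<open>The passage from the pair (k, x) to the pair (k + 1, \<Union>x), the recursion step for
  iterated unions.\<close>

definition iter_step :: "'a eps_struct \<Rightarrow> 'a \<Rightarrow> 'a \<Rightarrow> bool" where
  "iter_step M q p \<longleftrightarrow>
     (\<exists>k\<in>univ M. \<exists>x\<in>univ M. \<exists>s\<in>univ M. \<exists>u\<in>univ M.
        is_pair M q k x \<and> is_succ M s k \<and> is_Union M u x \<and> is_pair M p s u)"

text \<open>Finite pieces of the sequence \<open>a, \<Union>a, \<Union>\<Union>a, \<dots>\<close>: only closure under predecessors
  is required, which already determines the values at natural numbers.\<close>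

definition attempt :: "'a eps_struct \<Rightarrow> 'a \<Rightarrow> 'a \<Rightarrow> bool" where
  "attempt M a g \<longleftrightarrow>
     (\<forall>p. mem M p g \<longrightarrow>
        (\<exists>z\<in>univ M. is_empty M z \<and> is_pair M p z a) \<or>
        (\<exists>q. mem M q g \<and> iter_step M q p))"

definition iter_Union :: "'a eps_struct \<Rightarrow> 'a \<Rightarrow> 'a \<Rightarrow> 'a \<Rightarrow> bool" where
  "iter_Union M a n t \<longleftrightarrow>
     (\<exists>g\<in>univ M. attempt M a g \<and> (\<exists>p. mem M p g \<and> is_pair M p n t))"

lemma codefinable_iter_Union:
  "codefinable M N (\<lambda>e. iter_Union M (e k) (e m) (e n)) (\<lambda>e. iter_Union N (e k) (e m) (e n))"
  unfolding iter_Union_def attempt_def iter_step_def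
  by (intro codefinable_intros codefinable_is_empty codefinable_is_pair codefinable_is_succ
      codefinable_is_Union)

text \<open>Histories and levels in the sense of Scott and Potter: every \<open>v \<in> h\<close> is the union of the
  power sets of the members of \<open>v \<inter> h\<close>. In a model of ZFC the levels are the \<open>V\<^sub>\<alpha>\<close>.\<close>

definition history :: "'a eps_struct \<Rightarrow> 'a \<Rightarrow> bool" where
  "history M h \<longleftrightarrow>
     (\<forall>v. mem M v h \<longrightarrow>
        (\<forall>x. mem M x v \<longrightarrow> (\<exists>c. mem M c h \<and> mem M c v \<and> sub M x c)) \<and>
        (\<forall>c. mem M c h \<longrightarrow> mem M c v \<longrightarrow> (\<forall>x\<in>univ M. sub M x c \<longrightarrow> mem M x v)))"

definition level :: "'a eps_struct \<Rightarrow> 'a \<Rightarrow> bool" where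
  "level M v \<longleftrightarrow> (\<exists>h\<in>univ M. mem M v h \<and> history M h)"

lemma codefinable_level:
  "codefinable M N (\<lambda>e. level M (e m)) (\<lambda>e. level N (e m))"
  unfolding level_def history_def by (intro codefinable_intros codefinable_sub)

text \<open>Choosing the least level makes the assignment of a level to \<open>x\<close> functional,
  as replacement requires.\<close>

definition least_level :: "'a eps_struct \<Rightarrow> 'a \<Rightarrow> 'a \<Rightarrow> bool" where
  "least_level M x v \<longleftrightarrow>
     level M v \<and> mem M x v \<and> (\<forall>w\<in>univ M. level M w \<longrightarrow> mem M x w \<longrightarrow> sub M v w)"

lemma codefinable_least_level:
  "codefinable M N (\<lambda>e. least_level M (e m) (e n)) (\<lambda>e. least_level N (e m) (e n))"
  unfolding least_level_def by (intro codefinable_intros codefinable_level codefinable_sub)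

section \<open>Set theory inside a model\<close>

locale zfc =
  fixes M :: "'a eps_struct"
  assumes zfc: "ZFC_model M"
begin

abbreviation in_model (infix "\<^bold>\<in>" 50) where "x \<^bold>\<in> y \<equiv> mem M x y"
abbreviation sub_model (infix "\<^bold>\<subseteq>" 50) where "x \<^bold>\<subseteq> y \<equiv> sub M x y"

lemma mem_univ: assumes "x \<^bold>\<in> y" shows "x \<in> univ M" "y \<in> univ M"
  using assms by (auto simp: mem_def)

lemma subI: "(\<And>z. z \<^bold>\<in> x \<Longrightarrow> z \<^bold>\<in> y) \<Longrightarrow> x \<^bold>\<subseteq> y"
  by (simp add: sub_def)

lemma subD: "x \<^bold>\<subseteq> y \<Longrightarrow> z \<^bold>\<in> x \<Longrightarrow> z \<^bold>\<in> y"
  by (simp add: sub_def)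

lemma extensionality:
  assumes "x \<in> univ M" "y \<in> univ M" "\<And>z. z \<in> univ M \<Longrightarrow> z \<^bold>\<in> x \<longleftrightarrow> z \<^bold>\<in> y"
  shows "x = y"
proof -
  have "ax_extensionality M" using zfc by (simp add: ZFC_model_def)
  then show ?thesis using assms unfolding ax_extensionality_def mem_def by blast
qed

lemma foundation:
  assumes "y \<^bold>\<in> x"
  obtains m where "m \<^bold>\<in> x" "\<And>z. z \<^bold>\<in> m \<Longrightarrow> \<not> z \<^bold>\<in> x"
proof -
  have "ax_foundation M" using zfc by (simp add: ZFC_model_def)
  then show ?thesis using assms that unfolding ax_foundation_def mem_def by blast
qed

lemma pairing:
  assumes "x \<in> univ M" "y \<in> univ M"
  obtains p where "p \<in> univ M" "\<And>z. z \<^bold>\<in> p \<longleftrightarrow> z = x \<or> z = y"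
proof -
  have "ax_pairing M" using zfc by (simp add: ZFC_model_def)
  then show ?thesis using assms that unfolding ax_pairing_def mem_def by metis
qed

lemma Union:
  assumes "x \<in> univ M"
  obtains u where "u \<in> univ M" "\<And>z. z \<^bold>\<in> u \<longleftrightarrow> (\<exists>y. y \<^bold>\<in> x \<and> z \<^bold>\<in> y)"
proof -
  have "ax_union M" using zfc by (simp add: ZFC_model_def)
  then obtain u where "u \<in> univ M" and
      "\<forall>z\<in>univ M. z \<epsilon>\<^bsub>M\<^esub> u \<longleftrightarrow> (\<exists>y\<in>univ M. y \<epsilon>\<^bsub>M\<^esub> x \<and> z \<epsilon>\<^bsub>M\<^esub> y)"
    using bspec[OF _ assms] unfolding ax_union_def by blast
  then show ?thesis using assms by (intro that[of u]) (auto simp: mem_def)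
qed

lemma power_set:
  assumes "x \<in> univ M"
  obtains p where "p \<in> univ M" "\<And>y. y \<^bold>\<in> p \<longleftrightarrow> y \<in> univ M \<and> y \<^bold>\<subseteq> x"
proof -
  have "ax_power_set M" using zfc by (simp add: ZFC_model_def)
  then obtain p where p: "p \<in> univ M" "\<forall>y\<in>univ M. y \<epsilon>\<^bsub>M\<^esub> p \<longleftrightarrow> sub_in M y x"
    using bspec[OF _ assms] unfolding ax_power_set_def by blast
  then show ?thesis using assms
    by (intro that[of p]) (auto simp: mem_def sub_def sub_in_def)
qed

lemma separation:
  assumes "definable M (\<lambda>e. Q (e 0) (e 1) (e 2))"
    and "a \<in> univ M" "b \<in> univ M" "A \<in> univ M"
  obtains B where "B \<in> univ M" "\<And>x. x \<^bold>\<in> B \<longleftrightarrow> x \<^bold>\<in> A \<and> Q x a b"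
proof -
  obtain p where p: "\<And>e. assignment M e \<Longrightarrow> sat M e p \<longleftrightarrow> Q (e 0) (e 1) (e 2)"
    using assms(1) unfolding codefinable_def by blast
  \<comment> \<open>Slot 0 is reserved for the element being tested; \<open>b\<close> fills slot 2
    and serves as default elsewhere.\<close>
  define e where "e = (\<lambda>_::nat. b)(1 := a)"
  have ax: "ax_separation M" using zfc by (simp add: ZFC_model_def)
  have e: "assignment M e" using assms(2-3) by (auto simp: e_def assignment_def)
  obtain B where "B \<in> univ M"
      "\<forall>x\<in>univ M. x \<epsilon>\<^bsub>M\<^esub> B \<longleftrightarrow> x \<epsilon>\<^bsub>M\<^esub> A \<and> sat M (e(0 := x)) p"
    using ax[unfolded ax_separation_def, THEN spec[of _ p], THEN spec[of _ e], THEN mp, OF e,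
        THEN bspec, OF assms(4)] by blast
  moreover have "sat M (e(0 := x)) p \<longleftrightarrow> Q x a b" if "x \<in> univ M" for x
    using p[of "e(0 := x)"] assms(2-3) that by (auto simp: e_def assignment_def)
  ultimately show ?thesis using assms(4) by (intro that[of B]) (auto simp: mem_def)
qed

lemma replacement:
  assumes "definable M (\<lambda>e. R (e 0) (e 1) (e 2))"
    and "a \<in> univ M" "A \<in> univ M"
    and functional: "\<And>x y z. x \<^bold>\<in> A \<Longrightarrow> y \<in> univ M \<Longrightarrow> z \<in> univ M \<Longrightarrow> R x y a \<Longrightarrow> R x z a \<Longrightarrow> y = z"
  obtains B where "B \<in> univ M" "\<And>y. y \<^bold>\<in> B \<longleftrightarrow> y \<in> univ M \<and> (\<exists>x. x \<^bold>\<in> A \<and> R x y a)"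
proof -
  obtain p where p: "\<And>e. assignment M e \<Longrightarrow> sat M e p \<longleftrightarrow> R (e 0) (e 1) (e 2)"
    using assms(1) unfolding codefinable_def by blast
  define e where "e = (\<lambda>_::nat. a)"
  have ax: "ax_replacement M" using zfc by (simp add: ZFC_model_def)
  have e: "assignment M e" using assms(2) by (auto simp: e_def assignment_def)
  have sat: "sat M (e(0 := x, 1 := y)) p \<longleftrightarrow> R x y a" if "x \<in> univ M" "y \<in> univ M" for x y
    using p[of "e(0 := x, 1 := y)"] assms(2) that by (auto simp: e_def assignment_def)
  have "\<forall>x\<in>univ M. x \<epsilon>\<^bsub>M\<^esub> A \<longrightarrow>
      (\<forall>y\<in>univ M. \<forall>z\<in>univ M.
         sat M (e(0 := x, 1 := y)) p \<and> sat M (e(0 := x, 1 := z)) p \<longrightarrow> y = z)"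
  proof (intro ballI impI)
    fix x y z assume "x \<in> univ M" "x \<epsilon>\<^bsub>M\<^esub> A" "y \<in> univ M" "z \<in> univ M"
      "sat M (e(0 := x, 1 := y)) p \<and> sat M (e(0 := x, 1 := z)) p"
    then show "y = z" using functional[of x y z] assms(3) by (simp only: sat mem_def)
  qed
  then obtain B where "B \<in> univ M" "\<forall>y\<in>univ M. y \<epsilon>\<^bsub>M\<^esub> B \<longleftrightarrow>
      (\<exists>x\<in>univ M. x \<epsilon>\<^bsub>M\<^esub> A \<and> sat M (e(0 := x, 1 := y)) p)"
    using ax[unfolded ax_replacement_def, THEN spec[of _ p], THEN spec[of _ e], THEN mp, OF e,
        THEN bspec, OF assms(3)] by blast
  then show ?thesis using assms(3) sat by (intro that[of B]) (auto simp: mem_def)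
qed

text \<open>Foundation applied to the subset of \<open>A\<close> cut out by \<open>Q\<close>. As
  \<open>M\<close> may be ill-founded, induction on membership is available only in this internal
  form, for definable properties.\<close>

lemma definable_minimal:
  assumes "definable M (\<lambda>e. Q (e 0) (e 1) (e 2))"
    and "a \<in> univ M" "b \<in> univ M" "x \<^bold>\<in> A" "Q x a b"
  obtains m where "m \<^bold>\<in> A" "Q m a b" "\<And>z. z \<^bold>\<in> m \<Longrightarrow> z \<^bold>\<in> A \<Longrightarrow> \<not> Q z a b"
proof -
  obtain B where B: "\<And>x. x \<^bold>\<in> B \<longleftrightarrow> x \<^bold>\<in> A \<and> Q x a b"
    using separation[OF assms(1-3) mem_univ(2)[OF assms(4)]] by blast
  then have "x \<^bold>\<in> B" using assms by blast
  then obtain m where "m \<^bold>\<in> B" "\<And>z. z \<^bold>\<in> m \<Longrightarrow> \<not> z \<^bold>\<in> B" by (rule foundation) blast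
  then show ?thesis using that B by blast
qed

text \<open>Foundation for the set {x, y}. The case x = y gives irreflexivity.\<close>

lemma mem_asym: assumes "x \<^bold>\<in> y" shows "\<not> y \<^bold>\<in> x"
proof -
  obtain p where p: "\<And>z. z \<^bold>\<in> p \<longleftrightarrow> z = x \<or> z = y"
    using pairing assms mem_univ by metis
  then have "x \<^bold>\<in> p" by blast
  then obtain m where "m \<^bold>\<in> p" "\<And>z. z \<^bold>\<in> m \<Longrightarrow> \<not> z \<^bold>\<in> p" by (rule foundation) blast
  then show ?thesis using p assms by metis
qed

text \<open>The set is obtained as the union of {x, {y}}.\<close>

lemma insert:
  assumes "x \<in> univ M" "y \<in> univ M"
  obtains u where "u \<in> univ M" "\<And>z. z \<^bold>\<in> u \<longleftrightarrow> z \<^bold>\<in> x \<or> z = y"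
proof -
  obtain s where s: "s \<in> univ M" "\<And>z. z \<^bold>\<in> s \<longleftrightarrow> z = y \<or> z = y"
    using pairing assms(2) by blast
  obtain p where p: "p \<in> univ M" "\<And>z. z \<^bold>\<in> p \<longleftrightarrow> z = x \<or> z = s"
    using pairing assms(1) s(1) by blast
  obtain u where u: "u \<in> univ M" "\<And>z. z \<^bold>\<in> u \<longleftrightarrow> (\<exists>y. y \<^bold>\<in> p \<and> z \<^bold>\<in> y)"
    using Union p(1) by blast
  show ?thesis by (rule that[of u]) (use u p s in auto)
qed

text \<open>Distinct \<open>m\<close> and \<open>n\<close> with the same successor would be members
  of each other.\<close>

lemma succ_inj:
  assumes "is_succ M s m" "is_succ M s n" "m \<in> univ M" "n \<in> univ M"
  shows "m = n"
  using assms mem_asym unfolding is_succ_def by metis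

lemma succ_unique:
  "is_succ M s n \<Longrightarrow> is_succ M t n \<Longrightarrow> s \<in> univ M \<Longrightarrow> t \<in> univ M \<Longrightarrow> s = t"
  unfolding is_succ_def by (rule extensionality) auto

lemma empty_unique:
  "is_empty M x \<Longrightarrow> is_empty M y \<Longrightarrow> x \<in> univ M \<Longrightarrow> y \<in> univ M \<Longrightarrow> x = y"
  unfolding is_empty_def by (rule extensionality) auto

lemma Union_unique:
  "is_Union M u x \<Longrightarrow> is_Union M v x \<Longrightarrow> u \<in> univ M \<Longrightarrow> v \<in> univ M \<Longrightarrow> u = v"
  unfolding is_Union_def by (rule extensionality) auto

lemma upair_inj:
  assumes "is_upair M p x y" "is_upair M p x' y'"
    and "x \<in> univ M" "y \<in> univ M" "x' \<in> univ M" "y' \<in> univ M"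
  shows "x = x' \<and> y = y' \<or> x = y' \<and> y = x'"
  using assms unfolding is_upair_def by metis

lemma pair_inj:
  assumes "is_pair M p x y" "is_pair M p x' y'"
    and "x \<in> univ M" "y \<in> univ M" "x' \<in> univ M" "y' \<in> univ M"
  shows "x = x' \<and> y = y'"
proof -
  obtain s t where st: "s \<in> univ M" "t \<in> univ M" "is_upair M s x x" "is_upair M t x y" "is_upair M p s t"
    using assms(1) unfolding is_pair_def by blast
  obtain s' t' where st': "s' \<in> univ M" "t' \<in> univ M" "is_upair M s' x' x'" "is_upair M t' x' y'"
      "is_upair M p s' t'"
    using assms(2) unfolding is_pair_def by blast
  consider "s = s'" "t = t'" | "s = t'" "t = s'"
    using upair_inj[OF st(5) st'(5) st(1,2) st'(1,2)] by blast
  then show ?thesis using st(3,4) st'(3,4) assms(3-) upair_inj by cases metis+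
qed

lemma pair_ex:
  assumes "x \<in> univ M" "y \<in> univ M"
  obtains p where "p \<in> univ M" "is_pair M p x y"
proof -
  obtain s where s: "s \<in> univ M" "is_upair M s x x"
    using pairing[OF assms(1,1)] unfolding is_upair_def by metis
  obtain t where t: "t \<in> univ M" "is_upair M t x y"
    using pairing[OF assms] unfolding is_upair_def by metis
  obtain p where p: "p \<in> univ M" "is_upair M p s t"
    using pairing[OF s(1) t(1)] unfolding is_upair_def by metis
  show ?thesis using that[OF p(1)] s t p unfolding is_pair_def by blast
qed

section \<open>Natural numbers and transitive closures inside the model\<close>

lemma omega:
  obtains W where "is_inductive M W"
    and "\<And>J n. is_inductive M J \<Longrightarrow> J \<in> univ M \<Longrightarrow> n \<^bold>\<in> W \<Longrightarrow> n \<^bold>\<in> J"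
    and "\<exists>z. is_empty M z \<and> z \<^bold>\<in> W"
proof -
  have "ax_infinity M" using zfc by (simp add: ZFC_model_def)
  then obtain I u where I: "I \<in> univ M" and u: "u \<in> univ M" "u \<epsilon>\<^bsub>M\<^esub> I" "\<forall>z\<in>univ M. \<not> z \<epsilon>\<^bsub>M\<^esub> u"
    and S: "\<forall>x\<in>univ M. x \<epsilon>\<^bsub>M\<^esub> I \<longrightarrow> (\<exists>s\<in>univ M. s \<epsilon>\<^bsub>M\<^esub> I \<and>
              (\<forall>z\<in>univ M. z \<epsilon>\<^bsub>M\<^esub> s \<longleftrightarrow> z \<epsilon>\<^bsub>M\<^esub> x \<or> z = x))"
    unfolding ax_infinity_def by blast
  have u': "u \<^bold>\<in> I" "is_empty M u" using I u by (auto simp: mem_def is_empty_def)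
  have S': "\<exists>s. s \<^bold>\<in> I \<and> is_succ M s x" if "x \<^bold>\<in> I" for x
    using S that I unfolding mem_def is_succ_def by meson
  \<comment> \<open>The axiom supplies one empty set and one successor of each element in
    \<open>I\<close>, whereas \<open>is_inductive\<close> speaks of all of them; uniqueness bridges
    the gap.\<close>
  have indI: "is_inductive M I"
    unfolding is_inductive_def using u' S' succ_unique empty_unique mem_univ by metis
  \<comment> \<open>The intersection of all inductive sets, formed inside \<open>I\<close>. This is
    the \<omega> of the model, possibly nonstandard, so induction over it applies only to sets of
    the model.\<close>
  obtain W where W: "W \<in> univ M"
      "\<And>n. n \<^bold>\<in> W \<longleftrightarrow> n \<^bold>\<in> I \<and> (\<forall>J\<in>univ M. is_inductive M J \<longrightarrow> n \<^bold>\<in> J)"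
    by (rule separation[where Q="\<lambda>n _ _. \<forall>J\<in>univ M. is_inductive M J \<longrightarrow> n \<^bold>\<in> J", OF _ I I I],
       intro codefinable_intros codefinable_is_inductive) (rule that)
  have "is_inductive M W"
    unfolding is_inductive_def W(2)
    using indI unfolding is_inductive_def by blast
  moreover have "u \<^bold>\<in> W"
    using u' u(1) unfolding W(2) is_inductive_def by blast
  ultimately show ?thesis using that W u' by blast
qed

text \<open>A pair with empty first coordinate cannot arise from a recursion step, since successors
  are nonempty; so it is the initial pair. Conversely the singleton of (0, a) is an attempt.\<close>

lemma iter_Union_zero:
  assumes "is_empty M z" "z \<in> univ M" "a \<in> univ M" "t \<in> univ M"
  shows "iter_Union M a z t \<longleftrightarrow> t = a"
proof
  assume "iter_Union M a z t"
  then obtain g p where g: "attempt M a g" "p \<^bold>\<in> g" "is_pair M p z t"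
    unfolding iter_Union_def by blast
  from g(1,2) consider z' where "z' \<in> univ M" "is_pair M p z' a"
    | k s u where "k \<in> univ M" "s \<in> univ M" "u \<in> univ M" "is_succ M s k" "is_pair M p s u"
    unfolding attempt_def iter_step_def by blast
  then show "t = a"
  proof cases
    case 1
    then show ?thesis using pair_inj g(3) assms by blast
  next
    case 2
    then have "s = z" using pair_inj g(3) assms by blast
    then show ?thesis using 2 assms unfolding is_succ_def is_empty_def by blast
  qed
next
  assume "t = a"
  obtain p where p: "p \<in> univ M" "is_pair M p z a" using pair_ex assms by blast
  obtain g where g: "g \<in> univ M" "\<And>x. x \<^bold>\<in> g \<longleftrightarrow> x = p \<or> x = p" using pairing p by blast
  have "attempt M a g" unfolding attempt_def g(2) using p(2) assms(1,2) by blast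
  then show "iter_Union M a z t" unfolding iter_Union_def using \<open>t = a\<close> g p by blast
qed

text \<open>Adding the pair (s, u) to an attempt containing (n, t) gives an attempt again.\<close>

lemma iter_Union_succ:
  assumes "is_succ M s n" "is_Union M u t"
    and "iter_Union M a n t"
    and "n \<in> univ M" "s \<in> univ M" "t \<in> univ M" "u \<in> univ M"
  shows "iter_Union M a s u"
proof -
  obtain g q where g: "g \<in> univ M" "attempt M a g" "q \<^bold>\<in> g" "is_pair M q n t"
    using assms(3) unfolding iter_Union_def by blast
  obtain p where p: "p \<in> univ M" "is_pair M p s u" using pair_ex assms by blast
  obtain g' where g': "g' \<in> univ M" "\<And>x. x \<^bold>\<in> g' \<longleftrightarrow> x \<^bold>\<in> g \<or> x = p" using insert g(1) p(1) by blast
  have "attempt M a g'"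
    unfolding attempt_def
  proof (intro allI impI)
    fix p' assume "p' \<^bold>\<in> g'"
    then consider "p' \<^bold>\<in> g" | "p' = p" using g' by blast
    then show "(\<exists>z\<in>univ M. is_empty M z \<and> is_pair M p' z a) \<or>
        (\<exists>q. q \<^bold>\<in> g' \<and> iter_step M q p')"
    proof cases
      case 1
      then show ?thesis using g(2) g'(2) unfolding attempt_def by blast
    next
      case 2
      have "iter_step M q p" unfolding iter_step_def using g(4) p(2) assms by blast
      then show ?thesis using 2 g(3) g'(2) by blast
    qed
  qed
  then show ?thesis unfolding iter_Union_def using g' p by blast
qed

text \<open>A pair at a successor is not the initial one, so the attempt contains a predecessor
  pair; injectivity of successor shows that this pair sits at \<open>n\<close>.\<close>

lemma iter_Union_succD:
  assumes "is_succ M s n" "iter_Union M a s u" "a \<in> univ M" "n \<in> univ M" "s \<in> univ M" "u \<in> univ M"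
  obtains t where "t \<in> univ M" "iter_Union M a n t" "is_Union M u t"
proof -
  obtain g p where g: "g \<in> univ M" "attempt M a g" "p \<^bold>\<in> g" "is_pair M p s u"
    using assms(2) unfolding iter_Union_def by blast
  from g(2,3) consider z where "z \<in> univ M" "is_empty M z" "is_pair M p z a"
    | q k x s' u' where "q \<^bold>\<in> g" "k \<in> univ M" "x \<in> univ M" "s' \<in> univ M" "u' \<in> univ M"
      "is_pair M q k x" "is_succ M s' k" "is_Union M u' x" "is_pair M p s' u'"
    unfolding attempt_def iter_step_def by blast
  then show ?thesis
  proof cases
    case 1
    then have "z = s" using pair_inj g(4) assms by blast
    then show ?thesis using 1 assms unfolding is_succ_def is_empty_def by blast
  next
    case 2
    then have eq: "s' = s" "u' = u" using pair_inj g(4) assms by blast+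
    then have "k = n" using succ_inj 2 assms by blast
    then have "iter_Union M a n x" unfolding iter_Union_def using 2 g by blast
    then show ?thesis using that 2 eq by blast
  qed
qed

text \<open>The usual transitive closure: replacement collects the iterated unions of
  \<open>a\<close> into a set \<open>S\<close>, and \<open>T\<close> is \<Union>S. A member of the
  n-th iterate has its own members in the next one.\<close>

lemma transitive_superset:
  assumes a: "a \<in> univ M"
  obtains T where "T \<in> univ M" "a \<^bold>\<subseteq> T" "\<And>x y. x \<^bold>\<in> y \<Longrightarrow> y \<^bold>\<in> T \<Longrightarrow> x \<^bold>\<in> T"
proof -
  obtain W z where W: "is_inductive M W"
    and ind: "\<And>J n. is_inductive M J \<Longrightarrow> J \<in> univ M \<Longrightarrow> n \<^bold>\<in> W \<Longrightarrow> n \<^bold>\<in> J"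
    and z: "is_empty M z" "z \<^bold>\<in> W"
    by (rule omega) blast
  have WM: "W \<in> univ M" using z mem_univ by blast
  \<comment> \<open>Uniqueness of the value at \<open>n\<close>, proved by internal induction: the
    set \<open>J\<close> of all such \<open>n\<close> is inductive. The argument \<open>b\<close>
    only fits the format of \<open>separation\<close>.\<close>
  define Q where "Q n a b \<longleftrightarrow> (\<forall>t\<in>univ M. \<forall>t'\<in>univ M.
      iter_Union M a n t \<longrightarrow> iter_Union M a n t' \<longrightarrow> t = t')" for n a and b :: 'a
  have def: "definable M (\<lambda>e. Q (e 0) (e 1) (e 2))"
    unfolding Q_def by (intro codefinable_intros codefinable_iter_Union)
  obtain J where J: "J \<in> univ M" "\<And>n. n \<^bold>\<in> J \<longleftrightarrow> n \<^bold>\<in> W \<and> Q n a a"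
    by (rule separation[OF def a a WM]) (rule that)
  have "is_inductive M J"
    unfolding is_inductive_def
  proof (intro conjI ballI allI impI)
    fix z assume "z \<in> univ M" "is_empty M z"
    then show "z \<^bold>\<in> J"
      using W iter_Union_zero a unfolding J(2) Q_def is_inductive_def by blast
  next
    fix n s assume n: "n \<^bold>\<in> J" and s: "s \<in> univ M" "is_succ M s n"
    then have nM: "n \<in> univ M" and Q: "Q n a a" using mem_univ J by blast+
    have "Q s a a"
      unfolding Q_def
    proof (intro ballI impI)
      fix u v assume uv: "u \<in> univ M" "v \<in> univ M" "iter_Union M a s u" "iter_Union M a s v"
      obtain t where "t \<in> univ M" "iter_Union M a n t" "is_Union M u t"
        using iter_Union_succD s a nM uv by blast
      moreover obtain t' where "t' \<in> univ M" "iter_Union M a n t'" "is_Union M v t'"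
        using iter_Union_succD s a nM uv by blast
      ultimately show "u = v" using Q Union_unique uv unfolding Q_def by blast
    qed
    then show "s \<^bold>\<in> J" using W n s unfolding J(2) is_inductive_def by blast
  qed
  then have "Q n a a" if "n \<^bold>\<in> W" for n using ind J that by blast
  then have functional: "t = t'" if "n \<^bold>\<in> W" "t \<in> univ M" "t' \<in> univ M"
      "iter_Union M a n t" "iter_Union M a n t'" for n t t'
    using that unfolding Q_def by blast
  obtain S where S: "S \<in> univ M" "\<And>t. t \<^bold>\<in> S \<longleftrightarrow> t \<in> univ M \<and> (\<exists>n. n \<^bold>\<in> W \<and> iter_Union M a n t)"
    by (rule replacement[where R="\<lambda>n t a. iter_Union M a n t", OF _ a WM])
      (auto intro: codefinable_iter_Union functional)
  obtain T where T: "T \<in> univ M" "\<And>x. x \<^bold>\<in> T \<longleftrightarrow> (\<exists>t. t \<^bold>\<in> S \<and> x \<^bold>\<in> t)"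
    using Union S(1) by blast
  have "a \<^bold>\<in> S" using S(2) z a iter_Union_zero mem_univ by blast
  then have "a \<^bold>\<subseteq> T" using T by (auto simp: sub_def)
  moreover have "x \<^bold>\<in> T" if xy: "x \<^bold>\<in> y" "y \<^bold>\<in> T" for x y
  proof -
    obtain t n where t: "t \<in> univ M" "y \<^bold>\<in> t" "n \<^bold>\<in> W" "iter_Union M a n t" using xy(2) T S by blast
    have n: "n \<in> univ M" using t mem_univ by blast
    obtain s where s: "s \<in> univ M" "is_succ M s n"
      using insert[OF n n] unfolding is_succ_def by metis
    obtain u where u: "u \<in> univ M" "\<And>x. x \<^bold>\<in> u \<longleftrightarrow> (\<exists>y. y \<^bold>\<in> t \<and> x \<^bold>\<in> y)" using Union t(1) by blast
    then have "iter_Union M a s u"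
      using iter_Union_succ[OF s(2) _ t(4) n s(1) t(1) u(1)] unfolding is_Union_def by blast
    moreover have "s \<^bold>\<in> W" using W s t(3) unfolding is_inductive_def by blast
    ultimately have "u \<^bold>\<in> S" using S u(1) by blast
    then show ?thesis using T u t xy by blast
  qed
  ultimately show ?thesis using that T(1) by blast
qed

section \<open>Levels\<close>

lemma history_cover:
  "history M h \<Longrightarrow> v \<^bold>\<in> h \<Longrightarrow> x \<^bold>\<in> v \<Longrightarrow> \<exists>c. c \<^bold>\<in> h \<and> c \<^bold>\<in> v \<and> x \<^bold>\<subseteq> c"
  unfolding history_def by blast

lemma history_closed:
  "history M h \<Longrightarrow> v \<^bold>\<in> h \<Longrightarrow> c \<^bold>\<in> h \<Longrightarrow> c \<^bold>\<in> v \<Longrightarrow> x \<in> univ M \<Longrightarrow> x \<^bold>\<subseteq> c \<Longrightarrow> x \<^bold>\<in> v"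
  unfolding history_def by blast

text \<open>In a history, \<open>x\<close> is included in some earlier \<open>c\<close>, hence so is
  \<open>y\<close>, and \<open>v\<close> contains all subsets of \<open>c\<close>.\<close>

lemma level_subset_closed:
  assumes "level M v" "x \<^bold>\<in> v" "y \<in> univ M" "y \<^bold>\<subseteq> x"
  shows "y \<^bold>\<in> v"
proof -
  obtain h where h: "v \<^bold>\<in> h" "history M h" using assms unfolding level_def by blast
  then obtain c where "c \<^bold>\<in> h" "c \<^bold>\<in> v" "x \<^bold>\<subseteq> c" using history_cover assms by blast
  then show ?thesis using history_closed h assms unfolding sub_def by blast
qed

lemma level_transitive:
  assumes "level M v" "x \<^bold>\<in> v" "y \<^bold>\<in> x"
  shows "y \<^bold>\<in> v"
proof (rule ccontr)
  assume "\<not> y \<^bold>\<in> v"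
  obtain h where h: "v \<^bold>\<in> h" "history M h" using assms unfolding level_def by blast
  then have hM: "h \<in> univ M" using mem_univ by blast
  have def: "definable M (\<lambda>e. \<exists>x. x \<^bold>\<in> e 0 \<and> (\<exists>y. y \<^bold>\<in> x \<and> \<not> y \<^bold>\<in> e 0))"
    by (intro codefinable_intros)
  have "\<exists>x. x \<^bold>\<in> v \<and> (\<exists>y. y \<^bold>\<in> x \<and> \<not> y \<^bold>\<in> v)" using assms \<open>\<not> y \<^bold>\<in> v\<close> by blast
  then obtain m where m: "m \<^bold>\<in> h" "\<exists>x. x \<^bold>\<in> m \<and> (\<exists>y. y \<^bold>\<in> x \<and> \<not> y \<^bold>\<in> m)"
    and min: "\<And>c. c \<^bold>\<in> m \<Longrightarrow> c \<^bold>\<in> h \<Longrightarrow> \<not> (\<exists>x. x \<^bold>\<in> c \<and> (\<exists>y. y \<^bold>\<in> x \<and> \<not> y \<^bold>\<in> c))"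
    \<comment> \<open>Let \<open>m\<close> be a minimal non-transitive member of the history. The
      earlier \<open>c\<close> covering \<open>x\<close> is transitive by minimality, so
      \<open>y\<close> is a subset of \<open>c\<close> and therefore lies in
      \<open>m\<close>.\<close>
    by (rule definable_minimal[where Q="\<lambda>m _ _. \<exists>x. x \<^bold>\<in> m \<and> (\<exists>y. y \<^bold>\<in> x \<and> \<not> y \<^bold>\<in> m)",
          OF def hM hM h(1)]) (rule that)
  from m(2) obtain x y where xy: "x \<^bold>\<in> m" "y \<^bold>\<in> x" "\<not> y \<^bold>\<in> m" by blast
  obtain c where c: "c \<^bold>\<in> h" "c \<^bold>\<in> m" "x \<^bold>\<subseteq> c" using history_cover h m xy by blast
  have "y \<^bold>\<in> c" using c xy subD by blast
  then have "y \<^bold>\<subseteq> c" using min c unfolding sub_def by blast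
  then show False using history_closed h m c xy mem_univ by blast
qed

lemma mem_history_level: "history M h \<Longrightarrow> v \<^bold>\<in> h \<Longrightarrow> level M v"
  unfolding level_def using mem_univ by blast

text \<open>Double minimality: choose \<open>v\<close> minimal in its history among those
  incomparable with some member of \<open>k\<close>, then \<open>w\<close> minimal in
  \<open>k\<close> among those incomparable with \<open>v\<close>. These two turn out to be
  equal.\<close>

lemma level_linear:
  assumes "level M v" "level M w"
  shows "v \<^bold>\<in> w \<or> v = w \<or> w \<^bold>\<in> v"
proof (rule ccontr)
  assume contra: "\<not> (v \<^bold>\<in> w \<or> v = w \<or> w \<^bold>\<in> v)"
  obtain h where h: "v \<^bold>\<in> h" "history M h" using assms unfolding level_def by blast
  obtain k where k: "w \<^bold>\<in> k" "history M k" using assms unfolding level_def by blast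
  have M: "h \<in> univ M" "k \<in> univ M" using mem_univ h k by blast+
  have def: "definable M (\<lambda>e. \<exists>w. w \<^bold>\<in> e 1 \<and> \<not> (e 0 \<^bold>\<in> w \<or> e 0 = w \<or> w \<^bold>\<in> e 0))"
    by (intro codefinable_intros)
  have "\<exists>w. w \<^bold>\<in> k \<and> \<not> (v \<^bold>\<in> w \<or> v = w \<or> w \<^bold>\<in> v)" using contra k by blast
  then obtain v where v: "v \<^bold>\<in> h" "\<exists>w. w \<^bold>\<in> k \<and> \<not> (v \<^bold>\<in> w \<or> v = w \<or> w \<^bold>\<in> v)"
    and min_v: "\<And>v'. v' \<^bold>\<in> v \<Longrightarrow> v' \<^bold>\<in> h \<Longrightarrow> \<not> (\<exists>w. w \<^bold>\<in> k \<and> \<not> (v' \<^bold>\<in> w \<or> v' = w \<or> w \<^bold>\<in> v'))"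
    by (rule definable_minimal[where Q="\<lambda>v k _. \<exists>w. w \<^bold>\<in> k \<and> \<not> (v \<^bold>\<in> w \<or> v = w \<or> w \<^bold>\<in> v)",
          OF def M(2,2) h(1)]) (rule that)
  from v(2) obtain w where w: "w \<^bold>\<in> k" "\<not> (v \<^bold>\<in> w \<or> v = w \<or> w \<^bold>\<in> v)" by blast
  have vM: "v \<in> univ M" using v mem_univ by blast
  have def: "definable M (\<lambda>e. \<not> (e 1 \<^bold>\<in> e 0 \<or> e 1 = e 0 \<or> e 0 \<^bold>\<in> e 1))"
    by (intro codefinable_intros)
  obtain w where w: "w \<^bold>\<in> k" "\<not> (v \<^bold>\<in> w \<or> v = w \<or> w \<^bold>\<in> v)"
    and min_w: "\<And>w'. w' \<^bold>\<in> w \<Longrightarrow> w' \<^bold>\<in> k \<Longrightarrow> \<not> \<not> (v \<^bold>\<in> w' \<or> v = w' \<or> w' \<^bold>\<in> v)"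
    by (rule definable_minimal[where Q="\<lambda>w v _. \<not> (v \<^bold>\<in> w \<or> v = w \<or> w \<^bold>\<in> v)",
          OF def vM vM w]) (rule that)
  have lev: "level M v" "level M w" using mem_history_level h k v w by blast+
  \<comment> \<open>By minimality \<open>c\<close> is comparable with \<open>w\<close>; if
    \<open>w\<close> were equal to \<open>c\<close> or a member of it, transitivity of
    \<open>v\<close> would put \<open>w\<close> into \<open>v\<close>.\<close>
  have 1: "c \<^bold>\<in> w" if "c \<^bold>\<in> h" "c \<^bold>\<in> v" for c
    using min_v[OF that(2,1)] w that(2) level_transitive[OF lev(1) that(2)] by blast
  have 2: "c \<^bold>\<in> v" if "c \<^bold>\<in> k" "c \<^bold>\<in> w" for c
    using min_w[OF that(2,1)] w that(2) level_transitive[OF lev(2) that(2)] by blast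
  \<comment> \<open>Each member of \<open>v\<close> is a subset of some \<open>c\<close> as above,
    and levels are closed under subsets.\<close>
  have "x \<^bold>\<in> w" if x: "x \<^bold>\<in> v" for x
    using history_cover[OF h(2) v(1) x] 1 level_subset_closed[OF lev(2)] x mem_univ by blast
  moreover have "x \<^bold>\<in> v" if x: "x \<^bold>\<in> w" for x
    using history_cover[OF k(2) w(1) x] 2 level_subset_closed[OF lev(1)] x mem_univ by blast
  ultimately have "v = w" using extensionality vM w(1) mem_univ by blast
  then show False using w by blast
qed

text \<open>Let \<open>H\<close> consist of the levels lying in \<open>S\<close> or in \<Union>S,
  and let \<open>u\<close> be the union of the power sets of the members of \<open>H\<close>. Then
  \<open>H\<close> together with \<open>u\<close> is a history, so \<open>u\<close> is a
  level.\<close>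

lemma level_above:
  assumes S: "S \<in> univ M" "\<And>v. v \<^bold>\<in> S \<Longrightarrow> level M v"
  obtains u where "level M u" "u \<in> univ M" "\<And>v x. v \<^bold>\<in> S \<Longrightarrow> x \<in> univ M \<Longrightarrow> x \<^bold>\<subseteq> v \<Longrightarrow> x \<^bold>\<in> u"
proof -
  obtain U where U: "U \<in> univ M" "\<And>z. z \<^bold>\<in> U \<longleftrightarrow> (\<exists>v. v \<^bold>\<in> S \<and> z \<^bold>\<in> v)" using Union S(1) by blast
  obtain p where p: "p \<in> univ M" "\<And>y. y \<^bold>\<in> p \<longleftrightarrow> y \<in> univ M \<and> y \<^bold>\<subseteq> U"
    using power_set[OF U(1)] by blast
  \<comment> \<open>The subsets of \<open>U\<close> include all members of \<open>S\<close> and, by transitivity of levels, of \<open>\<Union>S\<close>.\<close>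
  obtain H where H: "H \<in> univ M"
      "\<And>w. w \<^bold>\<in> H \<longleftrightarrow> w \<^bold>\<in> p \<and> level M w \<and> (w \<^bold>\<in> S \<or> w \<^bold>\<in> U)"
    by (rule separation[where Q="\<lambda>w S U. level M w \<and> (w \<^bold>\<in> S \<or> w \<^bold>\<in> U)", OF _ S(1) U(1) p(1)],
       intro codefinable_intros codefinable_level) (rule that)
  have HI: "w \<^bold>\<in> H" if "level M w" "w \<^bold>\<in> S \<or> w \<^bold>\<in> U" for w
  proof -
    have "w \<^bold>\<subseteq> U" using that level_transitive S(2) unfolding sub_def U(2) by blast
    then show ?thesis using that H p mem_univ by blast
  qed
  \<comment> \<open>Thus the covering sets that an old member of \<open>H\<close> finds in its own
    history, being levels, lie in \<open>H\<close> as well.\<close>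
  have H_down: "c \<^bold>\<in> H" if "level M c" "c \<^bold>\<in> w" "w \<^bold>\<in> H" for c w
  proof -
    have "c \<^bold>\<in> U" using that H(2) p(2) subD by blast
    then show ?thesis using HI that by blast
  qed
  have S_sub: "v \<^bold>\<in> H" if "v \<^bold>\<in> S" for v using HI S(2) that by blast
  obtain u where u: "u \<in> univ M" "\<And>x. x \<^bold>\<in> u \<longleftrightarrow> x \<^bold>\<in> p \<and> (\<exists>c. c \<^bold>\<in> H \<and> x \<^bold>\<subseteq> c)"
    by (rule separation[where Q="\<lambda>x H _. \<exists>c. c \<^bold>\<in> H \<and> x \<^bold>\<subseteq> c", OF _ H(1) H(1) p(1)],
       intro codefinable_intros codefinable_sub) (rule that)
  have uI: "x \<^bold>\<in> u" if "x \<in> univ M" "c \<^bold>\<in> H" "x \<^bold>\<subseteq> c" for x c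
  proof -
    have "c \<^bold>\<subseteq> U" using that(2) H(2) p(2) by blast
    then have "x \<^bold>\<subseteq> U" using that(3) unfolding sub_def by blast
    then show ?thesis using that u(2) p(2) by blast
  qed
  obtain H' where H': "H' \<in> univ M" "\<And>x. x \<^bold>\<in> H' \<longleftrightarrow> x \<^bold>\<in> H \<or> x = u" using insert H(1) u(1) by blast
  have "history M H'"
    unfolding history_def
  proof (intro allI impI conjI ballI)
    fix v x assume v: "v \<^bold>\<in> H'" and x: "x \<^bold>\<in> v"
    show "\<exists>c. c \<^bold>\<in> H' \<and> c \<^bold>\<in> v \<and> x \<^bold>\<subseteq> c"
    proof (cases "v \<^bold>\<in> H")
      case True
      then have "level M v" using H(2) by blast
      then obtain h where h: "v \<^bold>\<in> h" "history M h" unfolding level_def by blast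
      then obtain c where "c \<^bold>\<in> h" "c \<^bold>\<in> v" "x \<^bold>\<subseteq> c" using history_cover x by blast
      then show ?thesis using H_down[OF _ _ True] mem_history_level h H' by blast
    next
      case False
      then have "v = u" using v H' by blast
      then obtain c where c: "c \<^bold>\<in> H" "x \<^bold>\<subseteq> c" using x u(2) by blast
      then have "c \<^bold>\<in> u" using uI mem_univ by (meson subI)
      then show ?thesis using c H' \<open>v = u\<close> by blast
    qed
  next
    fix v c x assume v: "v \<^bold>\<in> H'" and c: "c \<^bold>\<in> H'" "c \<^bold>\<in> v" and x: "x \<in> univ M" "x \<^bold>\<subseteq> c"
    show "x \<^bold>\<in> v"
    proof (cases "v \<^bold>\<in> H")
      case True
      then show ?thesis using level_subset_closed c x H(2) by blast
    next
      case False
      then have "v = u" using v H' by blast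
      moreover from this have "c \<noteq> u" using c mem_asym by blast
      ultimately show ?thesis using uI c H' x by blast
    qed
  qed
  then have "level M u" using mem_history_level H' by blast
  then show ?thesis using that u(1) uI S_sub by blast
qed

lemma least_level_ex:
  assumes "level M v" "x \<^bold>\<in> v"
  obtains u where "u \<in> univ M" "least_level M x u"
proof -
  have M: "v \<in> univ M" "x \<in> univ M" using assms mem_univ by blast+
  \<comment> \<open>By transitivity of \<open>v\<close>, this set contains every member of its
    members, so a level minimal in it is minimal among all levels containing \<open>x\<close>;
    linearity turns minimal into least.\<close>
  obtain A where A: "A \<in> univ M" "\<And>z. z \<^bold>\<in> A \<longleftrightarrow> z \<^bold>\<in> v \<or> z = v" using insert M by blast
  then have "v \<^bold>\<in> A" by blast
  have def: "definable M (\<lambda>e. level M (e 0) \<and> e 1 \<^bold>\<in> e 0)"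
    by (intro codefinable_intros codefinable_level)
  have "level M v \<and> x \<^bold>\<in> v" using assms by blast
  then obtain u where u: "u \<^bold>\<in> A" "level M u \<and> x \<^bold>\<in> u"
    and min: "\<And>w. w \<^bold>\<in> u \<Longrightarrow> w \<^bold>\<in> A \<Longrightarrow> \<not> (level M w \<and> x \<^bold>\<in> w)"
    by (rule definable_minimal[where Q="\<lambda>u x _. level M u \<and> x \<^bold>\<in> u", OF def M(2,2) \<open>v \<^bold>\<in> A\<close>])
      (rule that)
  have "u \<^bold>\<subseteq> w" if w: "level M w" "x \<^bold>\<in> w" for w
  proof -
    have "\<not> w \<^bold>\<in> u" using min w A(2) u(1) level_transitive assms(1) by blast
    then consider "u \<^bold>\<in> w" | "u = w" using level_linear u w by blast
    then show ?thesis using level_transitive w(1) unfolding sub_def by cases blast+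
  qed
  then show ?thesis using that u mem_univ unfolding least_level_def by blast
qed

text \<open>The rank argument: replacement collects the least levels of the members of
  \<open>a\<close>, and a level above all of these includes \<open>a\<close>.\<close>

lemma in_level_if_members:
  assumes a: "a \<in> univ M" "\<And>x. x \<^bold>\<in> a \<Longrightarrow> \<exists>v. level M v \<and> x \<^bold>\<in> v"
  shows "\<exists>v. level M v \<and> a \<^bold>\<in> v"
proof -
  have unique: "u = v" if "u \<in> univ M" "v \<in> univ M" "least_level M x u" "least_level M x v" for x u v
  proof -
    have "u \<^bold>\<subseteq> v" "v \<^bold>\<subseteq> u" using that unfolding least_level_def by blast+
    then show ?thesis using extensionality that(1,2) unfolding sub_def by blast
  qed
  obtain S where S: "S \<in> univ M" "\<And>v. v \<^bold>\<in> S \<longleftrightarrow> v \<in> univ M \<and> (\<exists>x. x \<^bold>\<in> a \<and> least_level M x v)"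
    by (rule replacement[where R="\<lambda>x v _. least_level M x v", OF _ a(1,1)])
      (auto intro: codefinable_least_level unique)
  have "level M v" if "v \<^bold>\<in> S" for v using S(2) that unfolding least_level_def by blast
  then obtain u where u: "level M u" "u \<in> univ M"
    "\<And>v x. v \<^bold>\<in> S \<Longrightarrow> x \<in> univ M \<Longrightarrow> x \<^bold>\<subseteq> v \<Longrightarrow> x \<^bold>\<in> u"
    using level_above[OF S(1)] by blast
  have "a \<^bold>\<subseteq> u"
  proof (rule subI)
    fix x assume x: "x \<^bold>\<in> a"
    then obtain v where v: "v \<in> univ M" "least_level M x v" using a(2) least_level_ex by metis
    then have "v \<^bold>\<in> u" using u(3)[of v v] S(2) x by (auto intro: subI)
    then show "x \<^bold>\<in> u" using level_transitive u(1) v unfolding least_level_def by blast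
  qed
  \<comment> \<open>So far \<open>a\<close> is only a subset of \<open>u\<close>; a level above {u}
    has it as a member.\<close>
  moreover obtain s where s: "s \<in> univ M" "\<And>z. z \<^bold>\<in> s \<longleftrightarrow> z = u \<or> z = u" using pairing u(2) by blast
  moreover have "level M v" if "v \<^bold>\<in> s" for v using that s(2) u(1) by simp
  then obtain w where "level M w" "\<And>v x. v \<^bold>\<in> s \<Longrightarrow> x \<in> univ M \<Longrightarrow> x \<^bold>\<subseteq> v \<Longrightarrow> x \<^bold>\<in> w"
    by (rule level_above[OF s(1)]) (assumption, rule that)
  ultimately show ?thesis using a(1) by blast
qed

text \<open>Induction on membership, run inside a transitive superset \<open>T\<close> of
  \<open>a\<close>. As \<open>a\<close> itself may lie outside \<open>T\<close>, the argument first
  passes to a member \<open>b\<close> of \<open>a\<close> that is in no level.\<close>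

lemma in_level:
  assumes a: "a \<in> univ M"
  obtains v where "level M v" "a \<^bold>\<in> v"
proof -
  have "\<exists>v. level M v \<and> a \<^bold>\<in> v"
  proof (rule ccontr)
    assume "\<nexists>v. level M v \<and> a \<^bold>\<in> v"
    then obtain b where b: "b \<^bold>\<in> a" "\<nexists>v. level M v \<and> b \<^bold>\<in> v" using in_level_if_members a by blast
    obtain T where T: "T \<in> univ M" "a \<^bold>\<subseteq> T" "\<And>x y. x \<^bold>\<in> y \<Longrightarrow> y \<^bold>\<in> T \<Longrightarrow> x \<^bold>\<in> T"
      using transitive_superset a by blast
    then have bT: "b \<^bold>\<in> T" using b subD by blast
    have def: "definable M (\<lambda>e. \<not> (\<exists>v\<in>univ M. level M v \<and> e 0 \<^bold>\<in> v))"
      by (intro codefinable_intros codefinable_level)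
    have "\<not> (\<exists>v\<in>univ M. level M v \<and> b \<^bold>\<in> v)" using b by blast
    then obtain m where m: "m \<^bold>\<in> T" "\<not> (\<exists>v\<in>univ M. level M v \<and> m \<^bold>\<in> v)"
      and min: "\<And>z. z \<^bold>\<in> m \<Longrightarrow> z \<^bold>\<in> T \<Longrightarrow> \<not> \<not> (\<exists>v\<in>univ M. level M v \<and> z \<^bold>\<in> v)"
      by (rule definable_minimal[where Q="\<lambda>m _ _. \<not> (\<exists>v\<in>univ M. level M v \<and> m \<^bold>\<in> v)", OF def a a bT])
        (rule that)
    have "m \<in> univ M" using m(1) mem_univ by blast
    moreover have "\<exists>v. level M v \<and> x \<^bold>\<in> v" if "x \<^bold>\<in> m" for x using min T(3) m(1) that by blast
    ultimately show False using in_level_if_members[of m] m(2) mem_univ by blast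
  qed
  then show ?thesis using that by blast
qed

lemma no_universal_set:
  assumes "u \<in> univ M"
  obtains x where "x \<in> univ M" "\<not> x \<^bold>\<in> u"
  using assms mem_asym by blast

end

section \<open>Closeness and preimages\<close>

lemma belongs_to_iff: "belongs_to S M \<longleftrightarrow> (\<exists>x\<in>univ M. S = {y. mem M y x})"
  unfolding belongs_to_def mem_def by auto

lemma derived_ultrafilter_eq:
  assumes "elementary_embedding M N j" "X \<in> univ M" "a \<in> univ N"
  shows "derived_ultrafilter M N j X a = {A \<in> univ M. sub M A X \<and> mem N a (j A)}"
  using assms
  by (auto simp: derived_ultrafilter_def Pow_in_def sub_in_def sub_def mem_def
      elementary_embedding_def)

theorem theorem3p19:
  fixes M :: "'a eps_struct" and N :: "'b eps_struct" and j :: "'a \<Rightarrow> 'b"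
  assumes "ZFC_model M" and "ZFC_model N" and "elementary_embedding M N j"
  shows "close_to M N j \<longleftrightarrow>
    (\<forall>A\<in>univ N. belongs_to {x \<in> univ M. j x \<epsilon>\<^bsub>N\<^esub> A} M)"
proof
  interpret M: zfc M by (rule zfc.intro) fact
  interpret N: zfc N by (rule zfc.intro) fact
  note el = \<open>elementary_embedding M N j\<close>
  have j: "j x \<in> univ N" if "x \<in> univ M" for x
    using el that by (simp add: elementary_embedding_def)
  have pre_eq: "{x \<in> univ M. j x \<epsilon>\<^bsub>N\<^esub> A} = {x \<in> univ M. mem N (j x) A}" if "A \<in> univ N" for A
    using that j by (auto simp: mem_def)
  {
    assume close: "close_to M N j"
    show "\<forall>A\<in>univ N. belongs_to {x \<in> univ M. j x \<epsilon>\<^bsub>N\<^esub> A} M"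
    proof
      fix A assume A: "A \<in> univ N"
      then obtain Y where Y: "Y \<in> univ M" "A \<epsilon>\<^bsub>N\<^esub> j Y"
        using close unfolding close_to_def cofinal_emb_def by blast
      then have AY: "mem N A (j Y)" using A j by (simp add: mem_def)
      have "belongs_to (derived_ultrafilter M N j Y A) M"
        using close A Y unfolding close_to_def by blast
      then obtain d where d: "d \<in> univ M" "\<And>B. mem M B d \<longleftrightarrow> B \<in> univ M \<and> sub M B Y \<and> mem N A (j B)"
        unfolding belongs_to_iff derived_ultrafilter_eq[OF el Y(1) A] by blast
      obtain U where U: "U \<in> univ M" "\<And>x. mem M x U \<longleftrightarrow> (\<exists>y. mem M y Y \<and> mem M x y)"
        using M.Union Y(1) by blast
      \<comment> \<open>Says that {B \<in> Y. x \<in> B} belongs to the ultrafilter coded by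
        \<open>d\<close>; the set \<open>U\<close>, the union of \<open>Y\<close>, is the bound that
        separation needs.\<close>
      define Q where "Q x d Y \<longleftrightarrow> (\<exists>s. mem M s d \<and>
          (\<forall>B\<in>univ M. mem M B s \<longleftrightarrow> mem M B Y \<and> mem M x B))" for x d Y
      have def: "definable M (\<lambda>e. Q (e 0) (e 1) (e 2))"
        unfolding Q_def by (intro codefinable_intros)
      obtain P where P: "P \<in> univ M" "\<And>x. mem M x P \<longleftrightarrow> mem M x U \<and> Q x d Y"
        by (rule M.separation[OF def d(1) Y(1) U(1)]) (rule that)
      have "mem M x P \<longleftrightarrow> mem N (j x) A" if x: "x \<in> univ M" for x
      proof -
        \<comment> \<open>In \<open>N\<close>, the set \<open>A\<close> witnesses that
          \<open>j x\<close> lies in a member of \<open>j Y\<close>; elementarity pulls this back to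
          \<open>x\<close> and \<open>Y\<close>.\<close>
        have "mem M x U" if xA: "mem N (j x) A"
        proof -
          have "(\<exists>y. mem M y Y \<and> mem M x y) \<longleftrightarrow> (\<exists>y. mem N y (j Y) \<and> mem N (j x) y)"
            by (rule elementary_embedding_iff[OF el, where P="\<lambda>x Y _. \<exists>y. mem M y Y \<and> mem M x y"
                  and Q="\<lambda>x Y _. \<exists>y. mem N y Y \<and> mem N x y", OF _ x Y(1) x])
              (intro codefinable_intros)
          then show ?thesis using U(2) xA AY by blast
        qed
        \<comment> \<open>By elementarity \<open>j s\<close> is {B \<in> j(Y). j(x) \<in> B}, and
          \<open>A\<close> is a member of \<open>j Y\<close>.\<close>
        moreover have "mem N A (j s) \<longleftrightarrow> mem N (j x) A"
          if s: "s \<in> univ M" "\<forall>B\<in>univ M. mem M B s \<longleftrightarrow> mem M B Y \<and> mem M x B" for s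
        proof -
          have "(\<forall>B\<in>univ M. mem M B s \<longleftrightarrow> mem M B Y \<and> mem M x B) \<longleftrightarrow>
              (\<forall>B\<in>univ N. mem N B (j s) \<longleftrightarrow> mem N B (j Y) \<and> mem N (j x) B)"
            by (rule elementary_embedding_iff[OF el,
                  where P="\<lambda>s Y x. \<forall>B\<in>univ M. mem M B s \<longleftrightarrow> mem M B Y \<and> mem M x B"
                  and Q="\<lambda>s Y x. \<forall>B\<in>univ N. mem N B s \<longleftrightarrow> mem N B Y \<and> mem N x B",
                  OF _ s(1) Y(1) x])
              (intro codefinable_intros)
          then show ?thesis using s A AY by blast
        qed
        moreover obtain s where s: "s \<in> univ M" "\<And>B. mem M B s \<longleftrightarrow> mem M B Y \<and> mem M x B"
          by (rule M.separation[where Q="\<lambda>B x _. mem M x B", OF _ x x Y(1)],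
             intro codefinable_intros) (rule that)
        ultimately show ?thesis
          unfolding P(2) Q_def d(2) sub_def by blast
      qed
      then have "{x \<in> univ M. j x \<epsilon>\<^bsub>N\<^esub> A} = {x. mem M x P}"
        unfolding pre_eq[OF A] using M.mem_univ by blast
      then show "belongs_to {x \<in> univ M. j x \<epsilon>\<^bsub>N\<^esub> A} M"
        unfolding belongs_to_iff using P(1) by blast
    qed
  next
    assume pre: "\<forall>A\<in>univ N. belongs_to {x \<in> univ M. j x \<epsilon>\<^bsub>N\<^esub> A} M"
    have pre: "\<exists>d\<in>univ M. \<forall>x\<in>univ M. mem M x d \<longleftrightarrow> mem N (j x) A" if A: "A \<in> univ N" for A
    proof -
      have "belongs_to {x \<in> univ M. j x \<epsilon>\<^bsub>N\<^esub> A} M" using pre A by blast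
      then show ?thesis unfolding belongs_to_iff pre_eq[OF A] by blast
    qed
    have "cofinal_emb M N j"
      unfolding cofinal_emb_def
    proof
      fix a assume "a \<in> univ N"
      then obtain A where A: "level N A" "mem N a A" using N.in_level by blast
      then obtain d where d: "d \<in> univ M" "\<forall>x\<in>univ M. mem M x d \<longleftrightarrow> mem N (j x) A"
        using pre N.mem_univ by blast
      obtain x where x: "x \<in> univ M" "\<not> mem M x d" using M.no_universal_set d(1) by blast
      obtain X where X: "level M X" "mem M x X" using M.in_level x(1) by blast
      have XM: "X \<in> univ M" using X M.mem_univ by blast
      have "level N (j X)"
        using elementary_embedding_iff[OF el, where P="\<lambda>x _ _. level M x" and
            Q="\<lambda>x _ _. level N x", OF codefinable_level XM XM XM] X(1) by simp
      moreover have "mem N (j x) (j X)" using elementary_embedding_mem_iff[OF el x(1) XM] X by blast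
      moreover have "\<not> mem N (j x) A" using d x by blast
      \<comment> \<open>The third alternative, \<open>j X\<close> in \<open>A\<close>, would put
        \<open>j x\<close> into \<open>A\<close> by transitivity.\<close>
      ultimately have "mem N A (j X) \<or> A = j X"
        using N.level_linear[OF A(1), of "j X"] N.level_transitive[OF A(1)] by blast
      then have "mem N a (j X)" using A N.level_transitive \<open>level N (j X)\<close> by blast
      then show "\<exists>X\<in>univ M. a \<epsilon>\<^bsub>N\<^esub> j X" using XM by (auto simp: mem_def)
    qed
    moreover have "belongs_to (derived_ultrafilter M N j X a) M"
      if X: "X \<in> univ M" and a: "a \<in> univ N" for X a
    proof -
      obtain p where p: "p \<in> univ M" "\<And>B. mem M B p \<longleftrightarrow> B \<in> univ M \<and> sub M B X"
        using M.power_set X by blast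
      obtain A where A: "A \<in> univ N" "\<And>B. mem N B A \<longleftrightarrow> mem N B (j p) \<and> mem N a B"
        by (rule N.separation[where Q="\<lambda>B a _. mem N a B", OF _ a a j[OF p(1)]],
           intro codefinable_intros) (rule that)
      obtain d where d: "d \<in> univ M" "\<forall>B\<in>univ M. mem M B d \<longleftrightarrow> mem N (j B) A" using pre A(1) by blast
      \<comment> \<open>The condition that \<open>j B\<close> lies in \<open>j p\<close> reduces by
        elementarity to \<open>B\<close> lying in the power set \<open>p\<close> of
        \<open>X\<close>.\<close>
      have "mem M B d \<longleftrightarrow> sub M B X \<and> mem N a (j B)" if "B \<in> univ M" for B
        using d that A(2) elementary_embedding_mem_iff[OF el that p(1)] p(2) by blast
      then have "derived_ultrafilter M N j X a = {B. mem M B d}"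
        unfolding derived_ultrafilter_eq[OF el X a] using M.mem_univ by blast
      then show ?thesis unfolding belongs_to_iff using d(1) by blast
    qed
    ultimately show "close_to M N j" unfolding close_to_def by blast
  }
qed

end
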